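(* Let $N$ be a timelike ruled surface of type $N_-$ in $\mathbb{R}_1^3$, $\vec r(s,v)=\vec c(s)+v\vec q(s)$, $s\in I$, with timelike striction curve $\vec c$, Frenet frame $\{\vec q,\vec h,\vec a\}$, curvatures $k_1,k_2$ and angle function $\theta$. Then the striction curve $\vec c$ is an asymptotic line on $N$ if and only if $\tanh\theta = k_1/k_2$ holds on $I$.
   Context: $\mathbb{R}_1^3$ is Minkowski 3-space with metric $\langle\cdot,\cdot\rangle=-dx_1^2+dx_2^2+dx_3^2$. A nonzero vector $\vec v$ is timelike if $\langle\vec v,\vec v\rangle<0$, null if $\langle\vec v,\vec v\rangle=0$, spacelike if $\langle\vec v,\vec v\rangle>0$. Setting. All functions are smooth on an open interval $I$. A timelike ruled surface of type $N_-$ with timelike striction curve is $\vec r(s,v)=\vec c(s)+v\vec q(s)$, with ruling direction $\vec q$ unit timelike, where $\vec c$ is its striction curve, a timelike curve parametrized by arc length $s$. It has a Frenet frame $\{\vec q,\vec h,\vec a\}$ of mutually orthogonal vectors, $\langle\vec q,\vec q\rangle=-1$, $\langle\vec h,\vec h\rangle=\langle\vec a,\vec a\rangle=1$ ($\vec h$ is the central normal, i.e. the surface normal along $\vec c$; $\vec a$ the central tangent), with $\vec q\,'=k_1\vec h$, $\vec h'=k_1\vec q+k_2\vec a$, $\vec a'=-k_2\vec h$ (prime is $d/ds$) for functions $k_1,k_2$. Standing assumption: the derivatives of the frame vectors are non-null and $N$ is non-cylindrical; in particular $k_1\neq0$ and $k_1^2\neq k_2^2$ everywhere. The unit tangent of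 $\vec c$ is $\vec c\,'=\vec t=\cosh\theta\,\vec q+\sinh\theta\,\vec a$ for a real function $\theta$ (the hyperbolic angle between $\vec t$ and $\vec q$). The curve $\vec c$ is an asymptotic line on $N$ if $\langle\vec h,\vec c\,''\rangle=0$ on $I$. Convention: an equation containing a quotient is understood to include that its denominator is nonzero. *)

theory Defs
  imports "HOL-Analysis.Analysis"
begin

text \<open>Minkowski 3-space: the coordinates are \<open>x $ 1, x $ 2, x $ 3\<close>, the first one carrying the
  negative sign.\<close>

definition mink :: "real^3 \<Rightarrow> real^3 \<Rightarrow> real" where
  "mink x y = - (x $ 1 * y $ 1) + x $ 2 * y $ 2 + x $ 3 * y $ 3"

definition timelike :: "real^3 \<Rightarrow> bool" where
  "timelike x \<longleftrightarrow> x \<noteq> 0 \<and> mink x x < 0"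

text \<open>The zero vector is not null.\<close>

definition null :: "real^3 \<Rightarrow> bool" where
  "null x \<longleftrightarrow> x \<noteq> 0 \<and> mink x x = 0"

abbreviation vd :: "(real \<Rightarrow> 'a::real_normed_vector) \<Rightarrow> real \<Rightarrow> 'a" where
  "vd f \<equiv> (\<lambda>t. vector_derivative f (at t))"

text \<open>Smoothness is only meant for open \<open>I\<close>, where \<open>at t\<close> and \<open>at t within I\<close> agree.\<close>

definition smooth_on_open :: "real set \<Rightarrow> (real \<Rightarrow> 'a::real_normed_vector) \<Rightarrow> bool" where
  "smooth_on_open I f \<longleftrightarrow> (\<forall>n. \<forall>t\<in>I. (vd ^^ n) f differentiable (at t))"

definition ruled_surface ::
    "(real \<Rightarrow> real^3) \<Rightarrow> (real \<Rightarrow> real^3) \<Rightarrow> real \<Rightarrow> real \<Rightarrow> real^3" where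
  "ruled_surface c q s v = c s + v *\<^sub>R q s"

definition partial_s :: "(real \<Rightarrow> real \<Rightarrow> real^3) \<Rightarrow> real \<Rightarrow> real \<Rightarrow> real^3" where
  "partial_s r s v = vector_derivative (\<lambda>\<sigma>. r \<sigma> v) (at s)"

definition partial_v :: "(real \<Rightarrow> real \<Rightarrow> real^3) \<Rightarrow> real \<Rightarrow> real \<Rightarrow> real^3" where
  "partial_v r s v = vector_derivative (\<lambda>\<nu>. r s \<nu>) (at v)"

text \<open>A ruled surface may have singular points, so the induced metric is required to be Lorentzian
  (i.e. \<open>E G - F\<^sup>2 < 0\<close>) only where the partial derivatives are linearly independent.\<close>

definition timelike_surface :: "real set \<Rightarrow> (real \<Rightarrow> real \<Rightarrow> real^3) \<Rightarrow> bool" where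
  "timelike_surface I r \<longleftrightarrow>
     (\<forall>s\<in>I. \<forall>v. partial_s r s v \<noteq> partial_v r s v \<and> independent {partial_s r s v, partial_v r s v} \<longrightarrow>
        mink (partial_s r s v) (partial_s r s v) * mink (partial_v r s v) (partial_v r s v)
          - (mink (partial_s r s v) (partial_v r s v))\<^sup>2 < 0)"

text \<open>The striction curve of the ruled surface with directrix \<open>k\<close> and ruling direction \<open>q\<close>;
  its point on the ruling through \<open>k s\<close> is the central point of that ruling.\<close>

definition striction_curve ::
    "(real \<Rightarrow> real^3) \<Rightarrow> (real \<Rightarrow> real^3) \<Rightarrow> real \<Rightarrow> real^3" where
  "striction_curve k q s = k s - (mink (vd q s) (vd k s) / mink (vd q s) (vd q s)) *\<^sub>R q s"

locale timelike_ruled_surface_N_minus =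
  fixes I :: "real set"
    and c q h a :: "real \<Rightarrow> real^3"
    and k1 k2 \<theta> :: "real \<Rightarrow> real"
  assumes interval: "open I" "is_interval I" "I \<noteq> {}"
    and smooth: "smooth_on_open I c" "smooth_on_open I q" "smooth_on_open I h"
      "smooth_on_open I a" "smooth_on_open I k1" "smooth_on_open I k2" "smooth_on_open I \<theta>"
    and timelike_surface: "timelike_surface I (ruled_surface c q)"
    and striction: "\<And>s. s \<in> I \<Longrightarrow> striction_curve c q s = c s"
    and timelike_c: "\<And>s. s \<in> I \<Longrightarrow> timelike (vd c s)"
    and arc_length: "\<And>s. s \<in> I \<Longrightarrow> \<bar>mink (vd c s) (vd c s)\<bar> = 1"
    and unit: "\<And>s. s \<in> I \<Longrightarrow> mink (q s) (q s) = -1"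
      "\<And>s. s \<in> I \<Longrightarrow> mink (h s) (h s) = 1"
      "\<And>s. s \<in> I \<Longrightarrow> mink (a s) (a s) = 1"
    and orthogonal: "\<And>s. s \<in> I \<Longrightarrow> mink (q s) (h s) = 0"
      "\<And>s. s \<in> I \<Longrightarrow> mink (q s) (a s) = 0"
      "\<And>s. s \<in> I \<Longrightarrow> mink (h s) (a s) = 0"
    and central_normal: "\<And>s. s \<in> I \<Longrightarrow> mink (h s) (partial_s (ruled_surface c q) s 0) = 0"
      "\<And>s. s \<in> I \<Longrightarrow> mink (h s) (partial_v (ruled_surface c q) s 0) = 0"
    and frenet: "\<And>s. s \<in> I \<Longrightarrow> vd q s = k1 s *\<^sub>R h s"
      "\<And>s. s \<in> I \<Longrightarrow> vd h s = k1 s *\<^sub>R q s + k2 s *\<^sub>R a s"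
      "\<And>s. s \<in> I \<Longrightarrow> vd a s = - k2 s *\<^sub>R h s"
    and derivatives_non_null: "\<And>s. s \<in> I \<Longrightarrow> \<not> null (vd q s)"
      "\<And>s. s \<in> I \<Longrightarrow> \<not> null (vd h s)"
      "\<And>s. s \<in> I \<Longrightarrow> \<not> null (vd a s)"
    and non_cylindrical: "\<And>s. s \<in> I \<Longrightarrow> vd q s \<noteq> 0"
    and tangent: "\<And>s. s \<in> I \<Longrightarrow> vd c s = cosh (\<theta> s) *\<^sub>R q s + sinh (\<theta> s) *\<^sub>R a s"
begin

text \<open>The usual conditions on the curvatures follow from non-cylindricity and the causal
  character of the derivatives; \<open>k2\<close> may still vanish, since \<open>vd a s = 0\<close> is not null.\<close>

lemma k1_nonzero: "s \<in> I \<Longrightarrow> k1 s \<noteq> 0"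
  using non_cylindrical[of s] frenet(1)[of s] by auto

lemma k1_k2_distinct:
  assumes s: "s \<in> I"
  shows "(k1 s)\<^sup>2 \<noteq> (k2 s)\<^sup>2"
proof
  assume eq: "(k1 s)\<^sup>2 = (k2 s)\<^sup>2"
  have bil: "mink (\<alpha> *\<^sub>R x + \<beta> *\<^sub>R y) (\<alpha>' *\<^sub>R x + \<beta>' *\<^sub>R y)
      = \<alpha> * \<alpha>' * mink x x + (\<alpha> * \<beta>' + \<beta> * \<alpha>') * mink x y + \<beta> * \<beta>' * mink y y" for \<alpha> \<beta> \<alpha>' \<beta>' x y
    by (simp add: mink_def algebra_simps)
  have "mink (vd h s) (vd h s) = 0"
    using bil[of "k1 s" "q s" "k2 s" "a s" "k1 s" "k2 s"] eq
    by (simp add: frenet(2)[OF s] unit[OF s] orthogonal[OF s] power2_eq_square)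
  moreover have "mink (vd h s) (q s) = - k1 s"
    using bil[of "k1 s" "q s" "k2 s" "a s" 1 0]
    by (simp add: frenet(2)[OF s] unit[OF s] orthogonal[OF s])
  then have "vd h s \<noteq> 0"
    using k1_nonzero[OF s] by (auto simp: mink_def)
  ultimately show False
    using derivatives_non_null(2)[OF s] by (simp add: null_def)
qed

end

text \<open>\<open>n\<close> is the surface normal along the curve \<open>c\<close>.\<close>

definition asymptotic_line ::
    "real set \<Rightarrow> (real \<Rightarrow> real^3) \<Rightarrow> (real \<Rightarrow> real^3) \<Rightarrow> bool" where
  "asymptotic_line I n c \<longleftrightarrow> (\<forall>s\<in>I. mink (n s) (vd (vd c) s) = 0)"

end

theory Submission
  imports Defs
begin

text \<open>Differentiate \<open>cosh \<theta> q + sinh \<theta> a\<close> by the Frenet formulas.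
  The terms containing the derivative of \<open>\<theta>\<close> lie along \<open>q\<close> and
  \<open>a\<close>, hence are orthogonal to \<open>h\<close>; what remains is the
  \<open>h\<close>-component \<open>k1 cosh \<theta> - k2 sinh \<theta>\<close>
  (\<open>normal_acceleration\<close>). Since \<open>cosh \<theta>\<close> is positive and
  \<open>k1\<close> never vanishes, this is zero exactly when \<open>k2\<close> is nonzero and
  \<open>tanh \<theta> = k1 / k2\<close> (\<open>normal_acceleration_eq_0_iff\<close>), pointwise on
  \<open>I\<close>.\<close>

context timelike_ruled_surface_N_minus
begin

lemma normal_acceleration:
  assumes s: "s \<in> I"
  shows "mink (h s) (vd (vd c) s) = k1 s * cosh (\<theta> s) - k2 s * sinh (\<theta> s)"
proof -
  have diff: "\<theta> differentiable (at s)" "q differentiable (at s)" "a differentiable (at s)"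
    using smooth(7,2,4) s unfolding smooth_on_open_def by (metis funpow_0)+
  obtain d where \<theta>': "(\<theta> has_real_derivative d) (at s)"
    using diff(1) real_differentiable_def by blast
  have q': "(q has_vector_derivative k1 s *\<^sub>R h s) (at s)"
    and a': "(a has_vector_derivative - k2 s *\<^sub>R h s) (at s)"
    using diff frenet(1,3)[OF s] vector_derivative_works by metis+
  have "((\<lambda>u. cosh (\<theta> u) *\<^sub>R q u + sinh (\<theta> u) *\<^sub>R a u) has_vector_derivative
      (cosh (\<theta> s) *\<^sub>R (k1 s *\<^sub>R h s) + (sinh (\<theta> s) * d) *\<^sub>R q s)
      + (sinh (\<theta> s) *\<^sub>R (- k2 s *\<^sub>R h s) + (cosh (\<theta> s) * d) *\<^sub>R a s)) (at s)"
    (is "(_ has_vector_derivative ?D) _")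
    by (intro has_vector_derivative_add has_vector_derivative_scaleR q' a')
      (auto intro!: derivative_eq_intros \<theta>')
  \<comment> \<open>The formula for \<open>vd c\<close> is known only on \<open>I\<close>; openness
    of \<open>I\<close> makes it valid near \<open>s\<close>, so the derivatives agree.\<close>
  then have "(vd c has_vector_derivative ?D) (at s)"
    by (rule has_vector_derivative_transform_within_open[OF _ interval(1) s]) (simp add: tangent)
  then have acc: "vd (vd c) s = ?D"
    by (rule vector_derivative_at)
  have "mink (h s) (vd (vd c) s) =
      (cosh (\<theta> s) * k1 s - sinh (\<theta> s) * k2 s) * mink (h s) (h s)
      + sinh (\<theta> s) * d * mink (q s) (h s) + cosh (\<theta> s) * d * mink (h s) (a s)"
    unfolding acc by (simp add: mink_def algebra_simps)
  then show ?thesis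
    by (simp add: unit(2)[OF s] orthogonal(1,3)[OF s] mult.commute)
qed

text \<open>The conjunct \<open>k2 s \<noteq> 0\<close> matters because division by zero gives 0 in
  HOL: at a point with \<open>k2 s = 0\<close> and \<open>\<theta> s = 0\<close> the bare equation
  would hold.\<close>

lemma normal_acceleration_eq_0_iff:
  assumes s: "s \<in> I"
  shows "mink (h s) (vd (vd c) s) = 0 \<longleftrightarrow> k2 s \<noteq> 0 \<and> tanh (\<theta> s) = k1 s / k2 s"
proof (cases "k2 s = 0")
  case True
  \<comment> \<open>Both sides are false: the normal component is
    \<open>k1 s * cosh (\<theta> s)\<close>, a product of nonzero factors.\<close>
  then show ?thesis
    using normal_acceleration[OF s] k1_nonzero[OF s] by simp
next
  case False
  then show ?thesis
    using normal_acceleration[OF s] by (auto simp: tanh_def field_simps)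
qed

end

theorem theorem3p1:
  fixes I :: "real set"
    and c q h a :: "real \<Rightarrow> real^3"
    and k1 k2 \<theta> :: "real \<Rightarrow> real"
  assumes "timelike_ruled_surface_N_minus I c q h a k1 k2 \<theta>"
  shows "asymptotic_line I h c \<longleftrightarrow> (\<forall>s\<in>I. k2 s \<noteq> 0 \<and> tanh (\<theta> s) = k1 s / k2 s)"
  unfolding asymptotic_line_def
  using timelike_ruled_surface_N_minus.normal_acceleration_eq_0_iff[OF assms] by simp

end
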